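(* Let $G$ be a connected bipartite graph which is not regular and has maximum degree $\Delta\geqslant 3$. Then $R(G)\leqslant\sqrt{\Delta-2}$.
   Context: All graphs are simple. For a graph $G$ of order $n$ with adjacency eigenvalues $\lambda_1\geqslant\cdots\geqslant\lambda_n$, the HL-index is $R(G)=\max\{|\lambda_{\lfloor (n+1)/2\rfloor}|,\ |\lambda_{\lceil (n+1)/2\rceil}|\}$. *)

theory Defs
  imports "Jordan_Normal_Form.Char_Poly"
begin

definition simple_graph :: "nat \<Rightarrow> (nat \<Rightarrow> nat \<Rightarrow> bool) \<Rightarrow> bool" where
  "simple_graph n E \<longleftrightarrow> (\<forall>i j. E i j \<longrightarrow> i < n \<and> j < n) \<and>
     (\<forall>i j. E i j \<longrightarrow> E j i) \<and> (\<forall>i. \<not> E i i)"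

definition degree :: "nat \<Rightarrow> (nat \<Rightarrow> nat \<Rightarrow> bool) \<Rightarrow> nat \<Rightarrow> nat" where
  "degree n E v = card {u. u < n \<and> E v u}"

definition max_degree :: "nat \<Rightarrow> (nat \<Rightarrow> nat \<Rightarrow> bool) \<Rightarrow> nat" where
  "max_degree n E = Max (degree n E ` {0..<n})"

definition regular_graph :: "nat \<Rightarrow> (nat \<Rightarrow> nat \<Rightarrow> bool) \<Rightarrow> bool" where
  "regular_graph n E \<longleftrightarrow> (\<exists>k. \<forall>v<n. degree n E v = k)"

definition connected_graph :: "nat \<Rightarrow> (nat \<Rightarrow> nat \<Rightarrow> bool) \<Rightarrow> bool" where
  "connected_graph n E \<longleftrightarrow> 0 < n \<and>
     (\<forall>u<n. \<forall>v<n. (\<lambda>x y. E x y)\<^sup>*\<^sup>* u v)"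

definition bipartite_graph :: "nat \<Rightarrow> (nat \<Rightarrow> nat \<Rightarrow> bool) \<Rightarrow> bool" where
  "bipartite_graph n E \<longleftrightarrow> (\<exists>A. \<forall>u<n. \<forall>v<n. E u v \<longrightarrow> (u \<in> A \<longleftrightarrow> v \<notin> A))"

definition adjacency_matrix :: "nat \<Rightarrow> (nat \<Rightarrow> nat \<Rightarrow> bool) \<Rightarrow> real mat" where
  "adjacency_matrix n E = mat n n (\<lambda>(i,j). if E i j then 1 else 0)"

text \<open>The eigenvalues of the adjacency matrix, with multiplicity, listed in
 non-increasing order: the unique non-increasingly sorted real list whose
 entries are the roots of the characteristic polynomial (adjacency matrices
 are real symmetric, so the characteristic polynomial splits over the reals).\<close>
definition adj_eigenvalues :: "nat \<Rightarrow> (nat \<Rightarrow> nat \<Rightarrow> bool) \<Rightarrow> real list" where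
  "adj_eigenvalues n E = (THE L. sorted (rev L) \<and>
      char_poly (adjacency_matrix n E) = (\<Prod>a\<leftarrow>L. [:- a, 1:]))"

text \<open>lambda_k, 1-based: lambda_1 \<ge> ... \<ge> lambda_n.\<close>
definition adj_eig :: "nat \<Rightarrow> (nat \<Rightarrow> nat \<Rightarrow> bool) \<Rightarrow> nat \<Rightarrow> real" where
  "adj_eig n E k = adj_eigenvalues n E ! (k - 1)"

definition HL_index :: "nat \<Rightarrow> (nat \<Rightarrow> nat \<Rightarrow> bool) \<Rightarrow> real" where
  "HL_index n E = max \<bar>adj_eig n E ((n + 1) div 2)\<bar> \<bar>adj_eig n E ((n + 2) div 2)\<bar>"

end

(* Write A for the adjacency matrix, D for the maximum degree and c(u,v) for the number of
   common neighbours of u and v, so that c(u,v) is the (u,v) entry of A^2. The spectrum of a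
   bipartite graph is symmetric about 0, so both median eigenvalues lie in [-m,m] as soon as one
   eigenvalue does, and for m^2 = D - 2 this holds unless A^2 - (D - 2) is positive definite.
   Assume it is, and test it on small integer vectors. All degrees are D or D - 1, c <= 1 off the
   diagonal, and two vertices of degree D - 1 ("deficient") have no common neighbour. Call
   u, v close if c(u,v) = 1. For a deficient v, the vectors 2v - u - u' and 2v - u - u' + y show
   that the vertices close to v are close to each other, and that a vertex close to two of them
   is close to v. Now take w1, w2 adjacent to v, u ~ w1 and u' ~ w2 with u, u' different from v,
   and a common neighbour w' of u and u'. Each neighbour of w' is close to v through a different
   neighbour of v, so w' is deficient. As w' is adjacent to u, it does not depend on u', which
   forces u' to be the only neighbour of w2 other than v. Then D = 3 and w2 is deficient too,
   although u' is a common neighbour of w2 and w'. *)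
theory Submission
  imports Defs "Jordan_Normal_Form.Schur_Decomposition" "HOL-Analysis.Function_Topology"
begin

section \<open>Variational construction of a small eigenvalue\<close>

text \<open>Tychonoff. Vectors will be functions on all of \<open>nat\<close>, so compactness has to
  come from the product topology.\<close>

lemma compact_box:
  fixes S :: "'i \<Rightarrow> real set"
  assumes "\<And>i. compact (S i)"
  shows "compact {f. \<forall>i. f i \<in> S i}"
proof -
  have "compactin (product_topology (\<lambda>_. euclidean) UNIV) (PiE UNIV S)"
    unfolding compactin_PiE using assms by simp
  then show ?thesis
    by (simp add: euclidean_product_topology PiE_UNIV_domain Pi_def)
qed

text \<open>The first-order condition at a minimum, without derivatives.\<close>

lemma linear_part_zero_of_nonneg_quadratic:
  fixes p q :: real
  assumes "\<And>t. 0 \<le> 2 * t * p + t\<^sup>2 * q"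
  shows "p = 0"
proof (rule ccontr)
  assume "p \<noteq> 0"
  \<comment> \<open>The vertex \<open>- p / q\<close> is of no use for \<open>q\<close> <= 0.
    Replacing \<open>q\<close> by the positive upper bound |q| + 1 only raises the quadratic, and
    the raised one is still negative at its own vertex.\<close>
  define t where "t = - p / (\<bar>q\<bar> + 1)"
  have "2 * t * p + t\<^sup>2 * q \<le> 2 * t * p + t\<^sup>2 * (\<bar>q\<bar> + 1)"
    by (intro add_left_mono mult_left_mono) auto
  also have "\<dots> = - (p\<^sup>2 / (\<bar>q\<bar> + 1))"
  proof -
    have "2 * (- p / s) * p + (- p / s)\<^sup>2 * s = - (p\<^sup>2 / s)" if "s > 0" for s
      using that by (simp add: power2_eq_square)
    from this[of "\<bar>q\<bar> + 1"] show ?thesis unfolding t_def by simp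
  qed
  also have "\<dots> < 0" using \<open>p \<noteq> 0\<close> by (simp add: divide_pos_pos)
  finally show False using assms[of t] by simp
qed

text \<open>A minimiser \<open>z\<close> of \<open>|Az|\<^sup>2\<close> on the unit sphere satisfies \<open>A\<^sup>2 z = m z\<close>; then
  \<open>(A - \<surd>m)(A + \<surd>m) z = 0\<close>, so \<open>\<surd>m\<close> or \<open>- \<surd>m\<close> is an eigenvalue.\<close>
lemma symmetric_small_eigenvalue:
  fixes a :: "nat \<Rightarrow> nat \<Rightarrow> real" and x :: "nat \<Rightarrow> real"
  assumes sym: "\<And>i j. a i j = a j i"
    and x: "i < n" "x i \<noteq> 0"
    and le: "(\<Sum>i<n. (\<Sum>j<n. a i j * x j)\<^sup>2) \<le> \<mu>\<^sup>2 * (\<Sum>i<n. (x i)\<^sup>2)"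
    and "\<mu> \<ge> 0"
  obtains z l where "\<bar>l\<bar> \<le> \<mu>" "\<exists>i<n. z i \<noteq> 0" "\<And>i. i < n \<Longrightarrow> (\<Sum>j<n. a i j * z j) = l * z i"
proof -
  define L where "L f i = (\<Sum>j<n. a i j * f j)" for f i
  define ip :: "(nat \<Rightarrow> real) \<Rightarrow> (nat \<Rightarrow> real) \<Rightarrow> real" where "ip f g = (\<Sum>i<n. f i * g i)" for f g
  have ip_self: "ip f f = (\<Sum>i<n. (f i)\<^sup>2)" for f by (simp add: ip_def power2_eq_square)
  have ip_nonneg: "ip f f \<ge> 0" for f by (simp add: ip_self sum_nonneg)
  have ip_pos: "ip f f > 0" if "i < n" "f i \<noteq> 0" for f i
    unfolding ip_self by (rule sum_pos2[of _ i]) (use that in auto)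
  have self_adjoint: "ip (L f) g = ip f (L g)" for f g
  proof -
    have "ip (L f) g = (\<Sum>i<n. \<Sum>j<n. a i j * f j * g i)"
      by (simp add: ip_def L_def sum_distrib_right)
    also have "\<dots> = (\<Sum>j<n. \<Sum>i<n. a i j * f j * g i)" by (rule sum.swap)
    also have "\<dots> = ip f (L g)"
      unfolding ip_def L_def sum_distrib_left by (intro sum.cong refl) (subst sym, simp)
    finally show ?thesis .
  qed
  have L_lin: "L (\<lambda>i. f i + t * g i) = (\<lambda>i. L f i + t * L g i)" for f g t
    by (auto simp: L_def fun_eq_iff sum.distrib algebra_simps sum_distrib_left)
  have ip_lin: "ip (\<lambda>i. f i + t * g i) (\<lambda>i. f i + t * g i) = ip f f + 2 * t * ip f g + t\<^sup>2 * ip g g" for f g t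
    by (simp add: ip_def sum.distrib algebra_simps sum_distrib_left power2_eq_square)
  \<comment> \<open>\<open>ip\<close> sees only the coordinates below \<open>n\<close>. The others
    are pinned to 0, since left free they would spoil compactness.\<close>
  define K where "K = {f. \<forall>i. f i \<in> (if i < n then {-1..1} else {0::real})} \<inter> {f. ip f f = 1}"
  have cont: "continuous_on A (\<lambda>f. ip f f)" "continuous_on A (\<lambda>f. ip (L f) (L f))" for A
    unfolding ip_def L_def
    by (intro continuous_intros continuous_on_subset[OF continuous_on_product_coordinates subset_UNIV])+
  have "closed {f. ip f f = 1}"
    by (intro closed_Collect_eq cont continuous_on_const)
  then have "compact K"
    unfolding K_def by (intro compact_Int_closed compact_box) auto
  define normalise where "normalise f = (\<lambda>i. if i < n then f i / sqrt (ip f f) else 0)" for f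
  have normalise: "normalise f \<in> K"
    "ip (L (normalise f)) (L (normalise f)) = ip (L f) (L f) / ip f f" if "ip f f > 0" for f
  proof -
    have "\<bar>f i / sqrt (ip f f)\<bar> \<le> 1" if "i < n" for i
    proof -
      have "(f i)\<^sup>2 \<le> ip f f" unfolding ip_self
        by (rule member_le_sum) (use that in auto)
      then have "\<bar>f i\<bar> \<le> sqrt (ip f f)" by (metis real_sqrt_abs real_sqrt_le_iff)
      then show ?thesis using \<open>ip f f > 0\<close> by (simp add: abs_divide)
    qed
    moreover have "ip (normalise f) (normalise f) = 1"
    proof -
      have "ip (normalise f) (normalise f) = (\<Sum>i<n. f i * f i / ip f f)"
        unfolding ip_def[of "normalise f"] using that
        by (intro sum.cong) (auto simp: normalise_def)
      then show ?thesis using that by (simp add: ip_def flip: sum_divide_distrib)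
    qed
    ultimately show "normalise f \<in> K"
      unfolding K_def by (auto simp: normalise_def abs_le_iff minus_le_iff simp del: abs_divide)
    have "L (normalise f) i = L f i / sqrt (ip f f)" for i
      by (simp add: L_def normalise_def sum_divide_distrib)
    then show "ip (L (normalise f)) (L (normalise f)) = ip (L f) (L f) / ip f f"
      using that unfolding ip_def[of "L _"] by (simp add: sum_divide_distrib)
  qed
  have xpos: "ip x x > 0" using ip_pos x by blast
  obtain z where z: "z \<in> K" and min: "\<And>f. f \<in> K \<Longrightarrow> ip (L z) (L z) \<le> ip (L f) (L f)"
    using continuous_attains_inf[OF \<open>compact K\<close> _ cont(2)] normalise(1)[OF xpos] by blast
  define m where "m = ip (L z) (L z)"
  have zz: "ip z z = 1" using z by (simp add: K_def)
  have "m \<ge> 0" by (simp add: m_def ip_nonneg)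
  have lower: "m * ip f f \<le> ip (L f) (L f)" for f
  proof (cases "ip f f > 0")
    case True
    then show ?thesis using min[OF normalise(1)[OF True]] normalise(2)[OF True]
      by (simp add: m_def field_simps)
  next
    case False
    then show ?thesis using ip_nonneg[of f] ip_nonneg[of "L f"] by simp
  qed
  have "m * ip x x \<le> \<mu>\<^sup>2 * ip x x"
    using lower[of x] le by (simp add: ip_self L_def)
  then have "m \<le> \<mu>\<^sup>2" using xpos by simp
  then have small: "sqrt m \<le> \<mu>" using \<open>\<mu> \<ge> 0\<close> by (simp add: real_le_lsqrt)
  \<comment> \<open>Varying \<open>z\<close> in the direction of its own residual \<open>r\<close>
    makes the linear coefficient equal to \<open>ip r r\<close>, so minimality forces
    \<open>r\<close> to vanish below \<open>n\<close>.\<close>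
  define r where "r i = L (L z) i - m * z i" for i
  have "ip (L z) (L r) - m * ip z r = 0"
  proof (rule linear_part_zero_of_nonneg_quadratic)
    fix t
    show "0 \<le> 2 * t * (ip (L z) (L r) - m * ip z r) + t\<^sup>2 * (ip (L r) (L r) - m * ip r r)"
      using lower[of "\<lambda>i. z i + t * r i"] unfolding L_lin ip_lin
      by (simp add: zz m_def[symmetric] algebra_simps)
  qed
  moreover have "ip (L z) (L r) - m * ip z r = ip r r"
    unfolding self_adjoint[symmetric, of "L z"]
    by (simp add: ip_def r_def algebra_simps sum_subtractf sum.distrib sum_distrib_left)
  ultimately have "ip r r = 0" by simp
  then have LL: "L (L z) i = m * z i" if "i < n" for i
    using ip_pos[OF that, of r] by (auto simp: r_def)
  define y where "y i = L z i + sqrt m * z i" for i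
  show ?thesis
  proof (cases "\<exists>i<n. y i \<noteq> 0")
    case True
    have "L y i = sqrt m * y i" if "i < n" for i
      using LL[OF that] \<open>m \<ge> 0\<close> unfolding y_def L_lin by (simp add: algebra_simps)
    then show ?thesis using that[of "sqrt m" y] True small \<open>m \<ge> 0\<close> by (simp add: L_def)
  next
    case False
    have "\<exists>i<n. z i \<noteq> 0"
      using zz by (auto simp: ip_def intro: ccontr)
    moreover have "L z i = - sqrt m * z i" if "i < n" for i
      using False that by (auto simp: y_def add_eq_0_iff)
    ultimately show ?thesis using that[of "- sqrt m" z] small \<open>m \<ge> 0\<close> by (simp add: L_def)
  qed
qed

section \<open>Characteristic polynomials of real symmetric and bipartite adjacency matrices\<close>

text \<open>Turns equality of factored polynomials into equality of spectra with multiplicity, both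
  for the symmetry of the spectrum and for the uniqueness of the sorted list.\<close>

lemma proots_prod_linear_factors:
  fixes L :: "'a :: idom list"
  shows "proots (\<Prod>a\<leftarrow>L. [:- a, 1:]) = mset L"
proof (induction L)
  case (Cons a L)
  have "(\<Prod>a\<leftarrow>L. [:- a, 1:]) \<noteq> 0" by (auto simp: prod_list_zero_iff)
  then show ?case using Cons by (simp add: proots_mult del: mult_pCons_left)
qed simp

text \<open>The Hermitian form \<open>Q\<close> of an eigenvector is \<open>k\<close> times its
  squared norm, and it is its own conjugate because the matrix is real and symmetric.\<close>

lemma real_symmetric_eigenvalue_real:
  fixes A :: "real mat"
  assumes A: "A \<in> carrier_mat n n" and sym: "\<And>i j. i < n \<Longrightarrow> j < n \<Longrightarrow> A $$ (i,j) = A $$ (j,i)"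
    and ev: "eigenvalue (map_mat complex_of_real A) k"
  shows "k \<in> \<real>"
proof -
  let ?C = "map_mat complex_of_real A"
  obtain v where v: "v \<in> carrier_vec n" "v \<noteq> 0\<^sub>v n" "?C *\<^sub>v v = k \<cdot>\<^sub>v v"
    using ev A unfolding eigenvalue_def eigenvector_def by auto
  have ev: "(\<Sum>j<n. of_real (A $$ (i,j)) * v $ j) = k * v $ i" if "i < n" for i
  proof -
    have "(?C *\<^sub>v v) $ i = (k \<cdot>\<^sub>v v) $ i" using v by simp
    then show ?thesis using that A v
      by (simp add: mult_mat_vec_def scalar_prod_def lessThan_atLeast0)
  qed
  define N where "N = (\<Sum>i<n. (cmod (v $ i))\<^sup>2)"
  define Q where "Q = (\<Sum>i<n. \<Sum>j<n. of_real (A $$ (i,j)) * v $ j * cnj (v $ i))"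
  have "Q = (\<Sum>i<n. (\<Sum>j<n. of_real (A $$ (i,j)) * v $ j) * cnj (v $ i))"
    by (simp add: Q_def sum_distrib_right)
  also have "\<dots> = (\<Sum>i<n. k * of_real ((cmod (v $ i))\<^sup>2))"
    by (intro sum.cong refl) (simp add: ev complex_norm_square mult.assoc del: of_real_power)
  also have "\<dots> = k * of_real N" by (simp add: N_def sum_distrib_left)
  finally have Q: "Q = k * of_real N" .
  have "cnj Q = (\<Sum>i<n. \<Sum>j<n. of_real (A $$ (i,j)) * cnj (v $ j) * v $ i)"
    by (simp add: Q_def)
  also have "\<dots> = (\<Sum>j<n. \<Sum>i<n. of_real (A $$ (i,j)) * cnj (v $ j) * v $ i)"
    by (rule sum.swap)
  also have "\<dots> = Q"
    unfolding Q_def by (intro sum.cong refl) (simp add: sym mult_ac)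
  finally have "cnj k * of_real N = k * of_real N" using Q by simp
  moreover have "N \<noteq> 0"
  proof
    assume "N = 0"
    then have "v $ i = 0" if "i < n" for i
      using that by (simp add: N_def sum_nonneg_eq_0_iff)
    then have "v = 0\<^sub>v n" using v(1) by (intro eq_vecI) auto
    then show False using v(2) by simp
  qed
  ultimately have "cnj k = k" by simp
  then show ?thesis by (metis Reals_cnj_iff)
qed

text \<open>The complex roots are all real, so the complex factorization is the image of a real one
  under an injective homomorphism.\<close>

lemma real_symmetric_char_poly_splits:
  fixes A :: "real mat"
  assumes A: "A \<in> carrier_mat n n" and sym: "\<And>i j. i < n \<Longrightarrow> j < n \<Longrightarrow> A $$ (i,j) = A $$ (j,i)"
  obtains L where "char_poly A = (\<Prod>a\<leftarrow>L. [:- a, 1:])" "length L = n"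
proof -
  interpret hom: map_poly_inj_idom_hom complex_of_real ..
  let ?C = "map_mat complex_of_real A"
  have C: "?C \<in> carrier_mat n n" using A by simp
  obtain K where K: "char_poly ?C = (\<Prod>a\<leftarrow>K. [:- a, 1:])" "length K = n"
    using char_poly_factorized[OF C] by blast
  have "k \<in> \<real>" if "k \<in> set K" for k
  proof -
    have "poly (char_poly ?C) k = 0" using K(1) that by (simp add: linear_poly_root)
    then show ?thesis
      using real_symmetric_eigenvalue_real[OF A sym] eigenvalue_root_char_poly[OF C] by blast
  qed
  then have "map (complex_of_real \<circ> Re) K = K" by (intro map_idI) simp
  then have "map_poly complex_of_real (char_poly A) = (\<Prod>a\<leftarrow>map (complex_of_real \<circ> Re) K. [:- a, 1:])"
    using K(1) of_real_hom.char_poly_hom[OF A] by metis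
  also have "\<dots> = map_poly complex_of_real (\<Prod>a\<leftarrow>map Re K. [:- a, 1:])"
    by (simp add: hom.hom_prod_list o_def)
  finally have "char_poly A = (\<Prod>a\<leftarrow>map Re K. [:- a, 1:])"
    by (rule hom.injectivity)
  then show ?thesis using that[of "map Re K"] K(2) by simp
qed

text \<open>Schur triangularisation puts the roots on a diagonal, where negation acts
  entrywise.\<close>

lemma char_poly_uminus:
  fixes A :: "'a :: conjugatable_ordered_field mat"
  assumes A: "A \<in> carrier_mat n n" and L: "char_poly A = (\<Prod>a\<leftarrow>L. [:- a, 1:])"
  shows "char_poly (- A) = (\<Prod>a\<leftarrow>L. [:a, 1:])"
proof -
  obtain B P Q where dec: "schur_decomposition A L = (B, P, Q)" by (cases "schur_decomposition A L")
  have wit: "similar_mat_wit A B P Q" and tri: "upper_triangular B" and diag: "diag_mat B = L"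
    using schur_decomposition[OF A L dec] by auto
  have carr: "B \<in> carrier_mat n n" "P \<in> carrier_mat n n" "Q \<in> carrier_mat n n"
    and PQ: "P * Q = 1\<^sub>m n" "Q * P = 1\<^sub>m n" "A = P * B * Q"
    using similar_mat_witD2[OF A wit] by auto
  have "- A = P * (- B) * Q"
    using carr PQ by simp
  then have "similar_mat (- A) (- B)"
    unfolding similar_mat_def by (intro exI[of _ P] exI[of _ Q] similar_mat_witI[OF PQ(1,2)]) (use A carr in auto)
  then have "char_poly (- A) = char_poly (- B)" by (rule char_poly_similar)
  also have "\<dots> = (\<Prod>a\<leftarrow>diag_mat (- B). [:- a, 1:])"
    by (rule char_poly_upper_triangular[of _ n]) (use tri carr in \<open>auto simp: upper_triangular_def\<close>)
  also have "diag_mat (- B) = map uminus L"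
    using carr unfolding diag[symmetric] diag_mat_def by auto
  finally show ?thesis by (simp add: o_def)
qed

lemma bipartite_spectrum_symmetric:
  assumes "simple_graph n E" "bipartite_graph n E"
    and L: "char_poly (adjacency_matrix n E) = (\<Prod>a\<leftarrow>L. [:- a, 1:])"
  shows "mset (map uminus L) = mset L"
proof -
  let ?A = "adjacency_matrix n E"
  obtain X where X: "\<And>u v. u < n \<Longrightarrow> v < n \<Longrightarrow> E u v \<Longrightarrow> (u \<in> X) = (v \<notin> X)"
    using assms(2) unfolding bipartite_graph_def by blast
  have A: "?A \<in> carrier_mat n n" by (simp add: adjacency_matrix_def)
  \<comment> \<open>Conjugation by the signature matrix of the bipartition negates the adjacency matrix.\<close>
  define D where "D = mat n n (\<lambda>(i,j). if i = j then if i \<in> X then 1 else - 1 else (0::real))"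
  have D: "D \<in> carrier_mat n n" by (simp add: D_def)
  have left: "D * M = mat n n (\<lambda>(i,j). (if i \<in> X then 1 else - 1) * M $$ (i,j))"
    if "M \<in> carrier_mat n n" for M
    using that
    by (intro eq_matI) (auto simp: D_def scalar_prod_def if_distrib[of "\<lambda>x. x * _"] cong: if_cong)
  have right: "M * D = mat n n (\<lambda>(i,j). M $$ (i,j) * (if j \<in> X then 1 else - 1))"
    if "M \<in> carrier_mat n n" for M
    using that
    by (intro eq_matI) (auto simp: D_def scalar_prod_def if_distrib[of "\<lambda>x. _ * x"] cong: if_cong)
  have DD: "D * D = 1\<^sub>m n"
    unfolding left[OF D] by (intro eq_matI) (auto simp: D_def)
  have "- ?A = D * ?A * D"
    unfolding left[OF A] by (subst right) (auto intro!: eq_matI simp: adjacency_matrix_def X)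
  then have "similar_mat (- ?A) ?A"
    unfolding similar_mat_def by (intro exI[of _ D] similar_mat_witI[OF DD DD]) (use A D in auto)
  then have "char_poly ?A = (\<Prod>a\<leftarrow>L. [:a, 1:])"
    using char_poly_similar char_poly_uminus[OF A L] by metis
  then have "(\<Prod>a\<leftarrow>map uminus L. [:- a, 1:]) = (\<Prod>a\<leftarrow>L. [:- a, 1:])"
    using L by (simp add: o_def)
  then show ?thesis by (metis proots_prod_linear_factors)
qed

section \<open>The sorted eigenvalue list and its median\<close>

text \<open>Discharges the \<open>THE\<close> of the definition: splitting gives existence, and
  sorted lists with the same multiset of roots coincide.\<close>

lemma adj_eigenvalues_spec:
  assumes "simple_graph n E"
  shows "sorted (rev (adj_eigenvalues n E))"
    "char_poly (adjacency_matrix n E) = (\<Prod>a\<leftarrow>adj_eigenvalues n E. [:- a, 1:])"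
    "length (adj_eigenvalues n E) = n"
proof -
  let ?A = "adjacency_matrix n E"
  let ?P = "\<lambda>L. sorted (rev L) \<and> char_poly ?A = (\<Prod>a\<leftarrow>L. [:- a, 1:])"
  have A: "?A \<in> carrier_mat n n" by (simp add: adjacency_matrix_def)
  have "?A $$ (i,j) = ?A $$ (j,i)" if "i < n" "j < n" for i j
    using assms that by (auto simp: adjacency_matrix_def simple_graph_def)
  then obtain L where L: "char_poly ?A = (\<Prod>a\<leftarrow>L. [:- a, 1:])" "length L = n"
    using real_symmetric_char_poly_splits[OF A] by blast
  let ?M = "rev (sort L)"
  have "(\<Prod>a\<leftarrow>?M. [:- a, 1:]) = (\<Prod>a\<leftarrow>L. [:- a, 1:])"
    by (simp flip: prod_mset_prod_list del: mult_pCons_left)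
  then have M: "?P ?M" using L by simp
  have uniq: "L' = ?M" if "?P L'" for L'
  proof -
    have "mset L' = mset ?M" by (metis that M proots_prod_linear_factors)
    then have "sort (rev L') = sort (rev ?M)" by (intro properties_for_sort) auto
    then have "rev L' = rev ?M" using that M by (simp only: sorted_sort_id)
    then show ?thesis by (simp only: rev_is_rev_conv)
  qed
  have "adj_eigenvalues n E = ?M"
    unfolding adj_eigenvalues_def using M uniq by (rule the_equality)
  then show "sorted (rev (adj_eigenvalues n E))"
    "char_poly ?A = (\<Prod>a\<leftarrow>adj_eigenvalues n E. [:- a, 1:])"
    "length (adj_eigenvalues n E) = n"
    using M L by auto
qed

text \<open>The index \<open>k\<close> is a 0-based median position: for even length \<open>2a\<close> the hypotheses admit
  \<open>a - 1\<close> and \<open>a\<close>, for odd length \<open>2a + 1\<close> only \<open>a\<close>.\<close>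
lemma symmetric_list_median_le:
  fixes L :: "real list"
  assumes sorted: "sorted (rev L)" and sym: "mset (map uminus L) = mset L"
    and small: "l \<in> set L" "\<bar>l\<bar> \<le> \<mu>"
    and k: "k < length L" "length L \<le> 2 * k + 2" "2 * k \<le> length L"
  shows "\<bar>L ! k\<bar> \<le> \<mu>"
proof -
  \<comment> \<open>Negation swaps the two filters, so they have equal length; \<open>l\<close> lies
    in neither, so each holds fewer than half of the entries. An entry above \<mu> at
    \<open>k\<close> would put \<open>k + 1\<close> entries into the first, one below -\<mu> would
    put \<open>length L - k\<close> into the second.\<close>
  let ?pos = "filter (\<lambda>a. \<mu> < a) L" and ?neg = "filter (\<lambda>a. a < - \<mu>) L"
  have "length ?pos = size (filter_mset (\<lambda>a. \<mu> < a) (mset (map uminus L)))"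
    unfolding sym by (simp flip: mset_filter)
  also have "\<dots> = length ?neg"
    by (simp add: filter_map o_def less_minus_iff del: mset_map flip: mset_filter)
  finally have eq: "length ?pos = length ?neg" .
  have "length ?pos + length ?neg = length (filter (\<lambda>a. \<mu> < a \<or> a < - \<mu>) L)"
  proof -
    have "\<mu> \<ge> 0" using small by linarith
    then show ?thesis by (induction L) auto
  qed
  also have "\<dots> < length L"
    by (rule length_filter_less[of l]) (use small in auto)
  finally have few: "2 * length ?pos < length L" "2 * length ?neg < length L" using eq by auto
  have mono: "L ! j \<le> L ! i" if "i \<le> j" "j < length L" for i j
    using sorted_rev_nth_mono[OF sorted that] .
  have "L ! k \<le> \<mu>"
  proof (rule ccontr)
    assume "\<not> ?thesis"
    then have "\<forall>i<k+1. \<mu> < L ! i" using mono k by (metis Suc_eq_plus1 less_Suc_eq_le not_le order.strict_trans2)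
    then have "{..<k+1} \<subseteq> {i. i < length L \<and> \<mu> < L ! i}" using k by auto
    then have "card {..<k+1} \<le> length ?pos"
      unfolding length_filter_conv_card by (intro card_mono) auto
    then show False using few k by simp
  qed
  moreover have "- \<mu> \<le> L ! k"
  proof (rule ccontr)
    assume "\<not> ?thesis"
    then have "\<forall>i. k \<le> i \<and> i < length L \<longrightarrow> L ! i < - \<mu>" using mono by (meson le_less_trans not_le)
    then have "{k..<length L} \<subseteq> {i. i < length L \<and> L ! i < - \<mu>}" by auto
    then have "card {k..<length L} \<le> length ?neg"
      unfolding length_filter_conv_card by (intro card_mono) auto
    then show False using few k by simp
  qed
  ultimately show ?thesis by linarith
qed

section \<open>Common neighbours and the combinatorial contradiction\<close>

definition codegree :: "nat \<Rightarrow> (nat \<Rightarrow> nat \<Rightarrow> bool) \<Rightarrow> nat \<Rightarrow> nat \<Rightarrow> nat" where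
  "codegree n E u v = card {w. w < n \<and> E u w \<and> E v w}"

lemma codegree_self: "codegree n E v v = degree n E v"
  by (simp add: codegree_def degree_def)

lemma codegree_commute: "codegree n E u v = codegree n E v u"
  by (simp add: codegree_def conj_commute)

lemma codegree_ge1:
  assumes "w < n" "E u w" "E v w"
  shows "1 \<le> codegree n E u v"
proof -
  have "card {w} \<le> card {w. w < n \<and> E u w \<and> E v w}"
    by (rule card_mono) (use assms in auto)
  then show ?thesis by (simp add: codegree_def)
qed

lemma codegree_ge1E:
  assumes "1 \<le> codegree n E u v"
  obtains w where "w < n" "E u w" "E v w"
proof -
  have "{w. w < n \<and> E u w \<and> E v w} \<noteq> {}"
    using assms by (intro notI) (simp add: codegree_def)
  then show ?thesis using that by blast
qed

lemma codegree_ge2: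
  assumes "w < n" "E u w" "E v w" "w' < n" "E u w'" "E v w'" "w \<noteq> w'"
  shows "2 \<le> codegree n E u v"
proof -
  have "card {w, w'} \<le> card {w. w < n \<and> E u w \<and> E v w}"
    by (rule card_mono) (use assms in auto)
  then show ?thesis using \<open>w \<noteq> w'\<close> by (simp add: codegree_def)
qed

lemma degree_le_max_degree: "v < n \<Longrightarrow> degree n E v \<le> max_degree n E"
  by (simp add: max_degree_def)

text \<open>\<open>pos\<close> is the positive definiteness of A^2 - (D - 2), written over a support
  \<open>S\<close> so that a test vector involves only the codegrees within its support.\<close>

lemma deficient_vertex_not_gapped:
  assumes graph: "simple_graph n E"
    and D3: "D \<ge> 3"
    and le: "\<And>v. v < n \<Longrightarrow> degree n E v \<le> D"
    and v: "v < n" "degree n E v < D"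
    and pos: "\<And>S x. \<lbrakk>S \<subseteq> {..<n}; \<exists>u\<in>S. x u \<noteq> 0\<rbrakk> \<Longrightarrow>
      (real D - 2) * (\<Sum>u\<in>S. (x u)\<^sup>2) <
      (\<Sum>u\<in>S. \<Sum>v\<in>S. real (codegree n E u v) * x u * x v)"
  shows False
proof -
  let ?c = "codegree n E" and ?d = "degree n E"
  have sym: "E i j \<Longrightarrow> E j i" and lt: "E i j \<Longrightarrow> i < n \<and> j < n" for i j
    using graph by (auto simp: simple_graph_def)
  have ler: "real (?d u) \<le> real D" if "u < n" for u
    using le[OF that] by simp
  have ge: "D - 1 \<le> ?d u" if "u < n" for u
    using pos[of "{u}" "\<lambda>_. 1"] that D3 by (auto simp: codegree_self)
  \<comment> \<open>The test vector u' - u gives 2(D - 2) < 2D - 2c.\<close>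
  have c_le1: "?c u u' \<le> 1" if "u < n" "u' < n" "u \<noteq> u'" for u u'
    using pos[of "{u,u'}" "(\<lambda>_. 1)(u := -1)"] that ler[of u] ler[of u']
    by (auto simp: codegree_self codegree_commute[of n E u' u])
  \<comment> \<open>The same vector, now with both degrees at most D - 1, gives c < 1.\<close>
  have deficient_far: False
    if "u < n" "u' < n" "u \<noteq> u'" "?d u < D" "?d u' < D" "E u w" "E u' w" for u u' w
  proof -
    have "real (?d u) \<le> real D - 1" "real (?d u') \<le> real D - 1" using that by auto
    moreover have "?c u u' \<ge> 1" using codegree_ge1[of w n E u u'] that lt by blast
    ultimately show False
      using pos[of "{u,u'}" "(\<lambda>_. 1)(u := -1)"] that
      by (auto simp: codegree_self codegree_commute[of n E u' u])
  qed
  have dv: "real (?d v) \<le> real D - 1" using v by auto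
  \<comment> \<open>The vector 2v - u - u' has squared norm 6. With c(u,u') = 0 its form is at most
    4(D - 1) + 2D - 8 = 6(D - 2), so strictness fails.\<close>
  have clique: "1 \<le> ?c u u'"
    if "u < n" "u' < n" "u \<noteq> u'" "u \<noteq> v" "u' \<noteq> v" "1 \<le> ?c v u" "1 \<le> ?c v u'" for u u'
  proof (rule ccontr)
    assume "\<not> 1 \<le> ?c u u'"
    then have "real (?c u u') = 0" "real (?c v u) \<ge> 1" "real (?c v u') \<ge> 1"
      using that by auto
    moreover define x :: "nat \<Rightarrow> real" where "x = (\<lambda>_. -1)(v := 2)"
    have x: "x v = 2" "x u = -1" "x u' = -1" using that(4,5) by (auto simp: x_def)
    have sum3: "sum f {v,u,u'} = f v + f u + f u'" for f :: "nat \<Rightarrow> real"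
      using that(3-5) by auto
    have "(real D - 2) * (\<Sum>a\<in>{v,u,u'}. (x a)\<^sup>2) <
        (\<Sum>a\<in>{v,u,u'}. \<Sum>b\<in>{v,u,u'}. real (?c a b) * x a * x b)"
      by (rule pos) (use that(1,2) v x in auto)
    then have "6 * (real D - 2) <
        4 * real (?d v) + real (?d u) + real (?d u') - 4 * real (?c v u) - 4 * real (?c v u')
        + 2 * real (?c u u')"
      unfolding sum3 x by (simp add: codegree_self codegree_commute[of n E u' u]
          codegree_commute[of n E u v] codegree_commute[of n E u' v])
    ultimately show False
      using dv ler[OF that(1)] ler[OF that(2)] by argo
  qed
  \<comment> \<open>The vector 2v - u - u' + y has squared norm 7. With c(y,v) = 0 and c(u,u') <= 1
    its form is at most 4(D - 1) + 3D - 12 + 2 = 7(D - 2).\<close>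
  have spread: "1 \<le> ?c y v"
    if "u < n" "u' < n" "y < n" "u \<noteq> u'" "u \<noteq> v" "u' \<noteq> v" "y \<noteq> v" "y \<noteq> u" "y \<noteq> u'"
      "1 \<le> ?c v u" "1 \<le> ?c v u'" "1 \<le> ?c y u" "1 \<le> ?c y u'" for u u' y
  proof (rule ccontr)
    assume "\<not> 1 \<le> ?c y v"
    then have "real (?c y v) = 0" by simp
    moreover have "real (?c u u') \<le> 1" using c_le1[of u u'] that by simp
    moreover have "real (?c v u) \<ge> 1" "real (?c v u') \<ge> 1" "real (?c y u) \<ge> 1" "real (?c y u') \<ge> 1"
      using that(10-13) by simp_all
    moreover define x :: "nat \<Rightarrow> real" where "x = (\<lambda>_. -1)(v := 2, y := 1)"
    have x: "x v = 2" "x u = -1" "x u' = -1" "x y = 1" using that(5-9) by (auto simp: x_def)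
    have sum4: "sum f {v,u,u',y} = f v + f u + f u' + f y" for f :: "nat \<Rightarrow> real"
      using that(4-9) by auto
    have "(real D - 2) * (\<Sum>a\<in>{v,u,u',y}. (x a)\<^sup>2) <
        (\<Sum>a\<in>{v,u,u',y}. \<Sum>b\<in>{v,u,u',y}. real (?c a b) * x a * x b)"
      by (rule pos) (use that(1-3) v x in auto)
    then have "7 * (real D - 2) <
        4 * real (?d v) + real (?d u) + real (?d u') + real (?d y) + 4 * real (?c y v)
        - 4 * real (?c v u) - 4 * real (?c v u') - 2 * real (?c y u) - 2 * real (?c y u')
        + 2 * real (?c u u')"
      unfolding sum4 x
      by (simp add: codegree_self codegree_commute[of n E u' u]
          codegree_commute[of n E u v] codegree_commute[of n E u' v]
          codegree_commute[of n E v y] codegree_commute[of n E u y] codegree_commute[of n E u' y])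
    ultimately show False
      using dv ler[OF that(1)] ler[OF that(2)] ler[OF that(3)] by argo
  qed
  \<comment> \<open>Codegrees of at most 1 rule out 4-cycles.\<close>
  have meet: "w = w'"
    if "E u w" "E u' w" "E u w'" "E u' w'" "u \<noteq> u'" for u u' w w'
    using codegree_ge2[of w n E u u' w'] c_le1[of u u'] that lt by fastforce
  have link: "\<exists>w'. ?d w' < D \<and> E w' u \<and> E w' u' \<and> \<not> E w' v"
    if w: "E v w1" "E v w2" "w1 \<noteq> w2" and u: "E w1 u" "u \<noteq> v" "E w2 u'" "u' \<noteq> v" for w1 w2 u u'
  proof -
    have uu': "u \<noteq> u'" using meet[of v w1 u w2] w u sym by blast
    have c: "1 \<le> ?c v u" "1 \<le> ?c v u'"
      using codegree_ge1[of w1 n E v u] codegree_ge1[of w2 n E v u'] w u sym lt by blast+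
    have lts: "u < n" "u' < n" using u lt by blast+
    obtain w' where w': "w' < n" "E u w'" "E u' w'"
      using codegree_ge1E[OF clique[OF lts uu' u(2,4) c]] by blast
    \<comment> \<open>Otherwise \<open>w'\<close> would be the common neighbour of \<open>v\<close>
      and \<open>u\<close>, which is \<open>w1\<close>, and also that of \<open>v\<close> and
      \<open>u'\<close>, which is \<open>w2\<close>.\<close>
    have nv: "\<not> E w' v"
    proof
      assume "E w' v"
      then have "w' = w1" "w' = w2"
        using meet[of u w' v w1] meet[of u' w' v w2] w u w' sym by blast+
      then show False using w by simp
    qed
    have near: "\<exists>w. E v w \<and> E y w" if y: "E w' y" for y
    proof -
      have "1 \<le> ?c y v"
      proof (cases "y = u \<or> y = u'")
        case True
        then show ?thesis using c codegree_commute by metis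
      next
        case False
        have "1 \<le> ?c y u" "1 \<le> ?c y u'"
          using codegree_ge1[of w' n E y u] codegree_ge1[of w' n E y u'] w' y sym by blast+
        then show ?thesis
          using spread[of u u' y] False lts lt[OF y] uu' u c nv y by blast
      qed
      then show ?thesis by (meson codegree_ge1E)
    qed
    define g where "g y = (SOME w. E v w \<and> E y w)" for y
    have g: "E v (g y)" "E y (g y)" if "E w' y" for y
      using someI_ex[OF near[OF that]] unfolding g_def by blast+
    \<comment> \<open>Two neighbours of \<open>w'\<close> with the same image would have both
      \<open>w'\<close> and that image as common neighbours. The image would then be
      \<open>w'\<close>, which is not adjacent to \<open>v\<close>.\<close>
    have "inj_on g {y. y < n \<and> E w' y}"
    proof (rule inj_onI)
      fix y y' assume "y \<in> {y. y < n \<and> E w' y}" "y' \<in> {y. y < n \<and> E w' y}" "g y = g y'"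
      then show "y = y'"
        using g[of y] g[of y'] meet[of y "g y" y' w'] nv sym by (metis mem_Collect_eq)
    qed
    moreover have "g ` {y. y < n \<and> E w' y} \<subseteq> {w. w < n \<and> E v w}"
      using g lt by blast
    ultimately have "?d w' \<le> ?d v"
      unfolding degree_def by (intro card_inj_on_le) auto
    then show ?thesis using v nv w' sym by (intro exI[of _ w']) auto
  qed
  have nbr: "\<exists>u. E w u \<and> u \<noteq> x" if "w < n" for w x
  proof (rule ccontr)
    assume "\<not> ?thesis"
    then have "{u. u < n \<and> E w u} \<subseteq> {x}" by auto
    then have "?d w \<le> card {x}" unfolding degree_def by (rule card_mono[rotated]) simp
    then show False using ge[OF that] D3 by simp
  qed
  obtain w1 where w1: "E v w1" using nbr v by blast
  obtain w2 where w2: "E v w2" "w1 \<noteq> w2" using nbr[OF v(1), of w1] by blast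
  obtain u where u: "E w1 u" "u \<noteq> v" using nbr[of w1 v] lt[OF w1] by blast
  obtain u' where u': "E w2 u'" "u' \<noteq> v" using nbr[of w2 v] lt[OF w2(1)] by blast
  obtain w' where w': "?d w' < D" "E w' u" "E w' u'" "\<not> E w' v"
    using link[OF w1 w2 u u'] by blast
  \<comment> \<open>\<open>u\<close> stays fixed while the neighbour of \<open>w2\<close> varies.
    Both vertices obtained from \<open>link\<close> are deficient and adjacent to \<open>u\<close>,
    hence equal.\<close>
  have only: "z = u'" if z: "E w2 z" "z \<noteq> v" for z
  proof (rule ccontr)
    assume "z \<noteq> u'"
    obtain w'' where w'': "?d w'' < D" "E w'' u" "E w'' z" "\<not> E w'' v"
      using link[OF w1 w2 u z] by blast
    have "w'' = w'" using deficient_far[of w'' w' u] w' w'' lt by blast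
    then have "w' = w2" using meet[of z w' u' w2] \<open>z \<noteq> u'\<close> w'' w' z u' sym by blast
    then show False using w' w2 sym by blast
  qed
  then have "{z. z < n \<and> E w2 z} \<subseteq> {v, u'}" by auto
  then have "?d w2 \<le> card {v, u'}" unfolding degree_def by (rule card_mono[rotated]) simp
  \<comment> \<open>A degree of at most 2 is below D. Now \<open>w2\<close> and \<open>w'\<close>
    are deficient and share \<open>u'\<close>, and they are distinct since only \<open>w2\<close> is
    adjacent to \<open>v\<close>.\<close>
  then have "?d w2 < D" using D3 u' by simp
  then show False using deficient_far[of w2 w' u'] w' w2 u' lt sym by blast
qed

section \<open>From a large HL-index to positive definiteness\<close>

text \<open>The test vector yields an eigenvalue in [-\<mu>, \<mu>], and the symmetry of the
  spectrum carries the bound to the medians. The contrapositive supplies positive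
  definiteness.\<close>

lemma HL_index_le:
  assumes graph: "simple_graph n E" and bip: "bipartite_graph n E"
    and x: "i < n" "x i \<noteq> 0"
    and le: "(\<Sum>i<n. (\<Sum>j<n. of_bool (E i j) * x j)\<^sup>2) \<le> \<mu>\<^sup>2 * (\<Sum>i<n. (x i)\<^sup>2)"
    and "\<mu> \<ge> 0"
  shows "HL_index n E \<le> \<mu>"
proof -
  let ?A = "adjacency_matrix n E" and ?L = "adj_eigenvalues n E"
  note L = adj_eigenvalues_spec[OF graph]
  have "E i j = E j i" for i j using graph by (auto simp: simple_graph_def)
  then have sym: "(of_bool (E i j) :: real) = of_bool (E j i)" for i j by simp
  obtain z l where z: "\<bar>l\<bar> \<le> \<mu>" "\<exists>i<n. z i \<noteq> 0"
      "\<And>i. i < n \<Longrightarrow> (\<Sum>j<n. of_bool (E i j) * z j) = l * z i"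
    using symmetric_small_eigenvalue[where a = "\<lambda>i j. of_bool (E i j)", OF sym x le \<open>\<mu> \<ge> 0\<close>] by metis
  have A: "?A \<in> carrier_mat n n" by (simp add: adjacency_matrix_def)
  have "eigenvector ?A (vec n z) l"
    unfolding eigenvector_def
  proof (intro conjI)
    show "vec n z \<in> carrier_vec (dim_row ?A)" using A by simp
    show "vec n z \<noteq> 0\<^sub>v (dim_row ?A)"
      using z(2) A by (metis carrier_matD(1) index_vec index_zero_vec(1))
    show "?A *\<^sub>v vec n z = l \<cdot>\<^sub>v vec n z"
    proof (rule eq_vecI)
      fix i assume "i < dim_vec (l \<cdot>\<^sub>v vec n z)"
      then have "i < n" by simp
      then have "(?A *\<^sub>v vec n z) $ i = (\<Sum>j<n. of_bool (E i j) * z j)"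
        by (simp add: adjacency_matrix_def scalar_prod_def lessThan_atLeast0 of_bool_def)
      then show "(?A *\<^sub>v vec n z) $ i = (l \<cdot>\<^sub>v vec n z) $ i" using z(3) \<open>i < n\<close> by simp
    qed (simp add: adjacency_matrix_def)
  qed
  then have "poly (char_poly ?A) l = 0"
    using eigenvalue_root_char_poly[OF A] by (auto simp: eigenvalue_def)
  then have l: "l \<in> set ?L" unfolding L(2) by (auto simp: poly_prod_list prod_list_zero_iff)
  have symL: "mset (map uminus ?L) = mset ?L"
    by (rule bipartite_spectrum_symmetric[OF graph bip L(2)])
  note median = symmetric_list_median_le[OF L(1) symL l z(1), unfolded L(3)]
  \<comment> \<open>\<open>i < n\<close> makes \<open>n\<close> positive, so the truncated
    subtraction of 1 yields valid 0-based positions.\<close>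
  have "\<bar>?L ! ((n + 1) div 2 - 1)\<bar> \<le> \<mu>" "\<bar>?L ! ((n + 2) div 2 - 1)\<bar> \<le> \<mu>"
    by (rule median; use x in presburger)+
  then show ?thesis by (simp add: HL_index_def adj_eig_def)
qed

text \<open>Expanding the squared norm of Ax and summing first over the middle vertex
  \<open>w\<close> of the walks u - w - v produces the codegrees.\<close>

lemma walk_form_eq:
  fixes x :: "nat \<Rightarrow> real"
  assumes "simple_graph n E" and S: "S \<subseteq> {..<n}"
  shows "(\<Sum>w<n. (\<Sum>u<n. of_bool (E w u) * (if u \<in> S then x u else 0))\<^sup>2)
    = (\<Sum>u\<in>S. \<Sum>v\<in>S. real (codegree n E u v) * x u * x v)"
proof -
  have inner: "(\<Sum>u<n. of_bool (E w u) * (if u \<in> S then x u else 0)) = (\<Sum>u\<in>S. of_bool (E w u) * x u)" for w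
    using S by (intro sum.mono_neutral_cong_right) auto
  have codeg: "real (codegree n E u v) = (\<Sum>w<n. of_bool (E w u) * of_bool (E w v))" for u v
  proof -
    have "{w. w < n \<and> E u w \<and> E v w} = {w \<in> {..<n}. E w u \<and> E w v}"
      using assms(1) by (auto simp: simple_graph_def)
    then have "real (codegree n E u v) = (\<Sum>w | w \<in> {..<n} \<and> E w u \<and> E w v. 1)"
      by (simp add: codegree_def)
    also have "\<dots> = (\<Sum>w<n. of_bool (E w u) * of_bool (E w v))"
      by (intro sum.mono_neutral_cong_left) auto
    finally show ?thesis .
  qed
  have "(\<Sum>w<n. (\<Sum>u\<in>S. of_bool (E w u) * x u)\<^sup>2)
      = (\<Sum>w<n. \<Sum>u\<in>S. \<Sum>v\<in>S. of_bool (E w u) * of_bool (E w v) * x u * x v)"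
    unfolding power2_eq_square sum_product by (intro sum.cong refl) (simp add: mult_ac)
  also have "\<dots> = (\<Sum>u\<in>S. \<Sum>w<n. \<Sum>v\<in>S. of_bool (E w u) * of_bool (E w v) * x u * x v)"
    by (rule sum.swap)
  also have "\<dots> = (\<Sum>u\<in>S. \<Sum>v\<in>S. \<Sum>w<n. of_bool (E w u) * of_bool (E w v) * x u * x v)"
    by (intro sum.cong refl sum.swap)
  also have "\<dots> = (\<Sum>u\<in>S. \<Sum>v\<in>S. real (codegree n E u v) * x u * x v)"
    by (simp only: codeg sum_distrib_right)
  finally show ?thesis unfolding inner .
qed

theorem theorem2p3:
  fixes n :: nat and E :: "nat \<Rightarrow> nat \<Rightarrow> bool"
  assumes "simple_graph n E"
    and "connected_graph n E"
    and "bipartite_graph n E"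
    and "\<not> regular_graph n E"
    and "max_degree n E \<ge> 3"
  shows "HL_index n E \<le> sqrt (real (max_degree n E) - 2)"
proof (rule ccontr)
  let ?D = "max_degree n E"
  let ?\<mu> = "sqrt (real ?D - 2)"
  assume gap: "\<not> HL_index n E \<le> ?\<mu>"
  have \<mu>: "?\<mu> \<ge> 0" "?\<mu>\<^sup>2 = real ?D - 2" using assms(5) by auto
  have le: "degree n E v \<le> ?D" if "v < n" for v
    using that by (rule degree_le_max_degree)
  \<comment> \<open>Failure of regularity provides the deficient vertex.\<close>
  obtain v where v: "v < n" "degree n E v < ?D"
    using assms(4) le unfolding regular_graph_def by (metis le_neq_implies_less)
  show False
  proof (rule deficient_vertex_not_gapped[OF assms(1,5) le v])
    fix S and x :: "nat \<Rightarrow> real"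
    assume S: "S \<subseteq> {..<n}" "\<exists>u\<in>S. x u \<noteq> 0"
    define y where "y u = (if u \<in> S then x u else 0)" for u
    obtain u where "u < n" "y u \<noteq> 0" using S by (auto simp: y_def)
    then have "\<not> (\<Sum>i<n. (\<Sum>j<n. of_bool (E i j) * y j)\<^sup>2) \<le> ?\<mu>\<^sup>2 * (\<Sum>i<n. (y i)\<^sup>2)"
      using HL_index_le[OF assms(1,3) _ _ _ \<mu>(1)] gap by blast
    moreover have "(\<Sum>i<n. (y i)\<^sup>2) = (\<Sum>u\<in>S. (x u)\<^sup>2)"
      using S(1) by (intro sum.mono_neutral_cong_right) (auto simp: y_def)
    ultimately show "(real ?D - 2) * (\<Sum>u\<in>S. (x u)\<^sup>2)
        < (\<Sum>u\<in>S. \<Sum>v\<in>S. real (codegree n E u v) * x u * x v)"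
      using walk_form_eq[OF assms(1) S(1), of x] \<mu>(2) by (simp add: y_def)
  qed
qed

end
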